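(* Let $t,w,v$ be positive integers with $v\ge w$, let $w\equiv d+1\pmod{t^2}$ where $0\le d\le t^2-1$, and let $\tau=\lceil w/t^2\rceil$. If there exists a $\tau$-$(v-d,w-d,1)$ design, then there exists a $t$-TS$(w,v)$ with cardinality (number of blocks) $\binom{v-d}{\tau}/\binom{w-d}{\tau}$.
   Context: A set system is a pair $(\mathcal{X},\mathcal{B})$ where $\mathcal{X}$ is a finite set of points and $\mathcal{B}$ is a collection (set) of subsets of $\mathcal{X}$ called blocks. $\binom{\mathcal{X}}{w}$ denotes the collection of all $w$-subsets of $\mathcal{X}$. A $\tau$-$(v,w,\lambda)$ design is a set system $(\mathcal{X},\mathcal{B})$, where $\mathcal{X}$ is a $v$-set of points and $\mathcal{B}$ is a collection of $w$-subsets of $\mathcal{X}$, such that every $\tau$-subset of $\mathcal{X}$ is contained in exactly $\lambda$ blocks. A $t$-traceability scheme $t$-TS$(w,v)$ is a set system $(\mathcal{X},\mathcal{B})$ with $|\mathcal{X}|=v$ and $\mathcal{B}\subseteq\binom{\mathcal{X}}{w}$ such that for every choice of $s$ blocks $B_1,\ldots,B_s\in\mathcal{B}$ with $1\le s\le t$ and for any $w$-subset $T\subseteq\bigcup_{1\le j\le s}B_j$, there does not exist a block $B\in\mathcal{B}\setminus\{B_1,\ldots,B_s\}$ such that $|T\cap B|\ge|T\cap B_j|$ for all $1\le j\le s$. *)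

theory Defs
  imports Complex_Main "HOL-Library.Ramsey" "HOL-Number_Theory.Cong"
begin

definition set_system :: "'a set \<Rightarrow> 'a set set \<Rightarrow> bool" where
  "set_system X \<B> \<longleftrightarrow> finite X \<and> \<B> \<subseteq> Pow X"

definition is_design :: "nat \<Rightarrow> nat \<Rightarrow> nat \<Rightarrow> nat \<Rightarrow> 'a set \<Rightarrow> 'a set set \<Rightarrow> bool" where
  "is_design \<tau> v w \<mu> X \<B> \<longleftrightarrow>
     set_system X \<B> \<and> card X = v \<and> \<B> \<subseteq> nsets X w \<and>
     (\<forall>S \<in> nsets X \<tau>. card {B \<in> \<B>. S \<subseteq> B} = \<mu>)"

text \<open>
  The chosen blocks \<open>C 1, \<dots>, C s\<close> need not be distinct; this does not matter, since
  dropping repetitions only decreases \<open>s\<close> and leaves the condition unchanged.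
\<close>

definition is_traceability_scheme :: "nat \<Rightarrow> nat \<Rightarrow> nat \<Rightarrow> 'a set \<Rightarrow> 'a set set \<Rightarrow> bool" where
  "is_traceability_scheme t w v X \<B> \<longleftrightarrow>
     set_system X \<B> \<and> card X = v \<and> \<B> \<subseteq> nsets X w \<and>
     (\<forall>s (C :: nat \<Rightarrow> 'a set) T.
        1 \<le> s \<and> s \<le> t \<and> (\<forall>j\<in>{1..s}. C j \<in> \<B>) \<and> T \<in> nsets (\<Union>j\<in>{1..s}. C j) w \<longrightarrow>
        \<not> (\<exists>B \<in> \<B> - C ` {1..s}. \<forall>j\<in>{1..s}. card (T \<inter> B) \<ge> card (T \<inter> C j)))"

end

theory Submission imports Defs begin

text \<open>
  Write \<open>w = (\<tau> - 1) * t\<^sup>2 + 1 + d\<close> and add the same \<open>d\<close> new points to every block of the design.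
  A \<open>w\<close>-subset \<open>T\<close> of a union of at most \<open>t\<close> enlarged blocks has at least \<open>(\<tau> - 1) * t\<^sup>2 + 1\<close>
  old points, so some block of the union contains more than \<open>(\<tau> - 1) * t\<close> of them. Any other block
  meets each block of the union in at most \<open>\<tau> - 1\<close> old points, hence contains at most
  \<open>(\<tau> - 1) * t\<close> old points of \<open>T\<close>. The new points contribute equally to all intersections.
\<close>

lemma card_nsets: "finite A \<Longrightarrow> card (nsets A k) = card A choose k"
  unfolding nsets_def using n_subsets[of A k]
  by (metis (no_types, lifting) Collect_cong finite_subset)

text \<open>The type \<open>'a\<close> may have no room for \<open>d\<close> further points, so the
  design is first carried over to an initial segment of the naturals.\<close>

lemma is_design_image:
  assumes des: "is_design \<tau> v w \<mu> X \<A>" and f: "bij_betw f X Y"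
  shows "is_design \<tau> v w \<mu> Y ((`) f ` \<A>)"
proof -
  have inj: "inj_on f X" and Y: "Y = f ` X"
    using f by (auto simp: bij_betw_def)
  have X: "finite X" "\<A> \<subseteq> Pow X" "card X = v" "\<A> \<subseteq> nsets X w"
    and S: "\<And>S. S \<in> nsets X \<tau> \<Longrightarrow> card {B \<in> \<A>. S \<subseteq> B} = \<mu>"
    using des by (auto simp: is_design_def set_system_def)
  have "(`) f ` \<A> \<subseteq> nsets Y w"
  proof
    fix B assume "B \<in> (`) f ` \<A>"
    then obtain B' where B': "B' \<in> \<A>" "B = f ` B'" by blast
    then have "B' \<subseteq> X" "finite B'" "card B' = w" using X by (auto simp: nsets_def)
    then show "B \<in> nsets Y w"
      using B' inj Y by (auto simp: nsets_def card_image inj_on_subset)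
  qed
  moreover have "card {B \<in> (`) f ` \<A>. S \<subseteq> B} = \<mu>" if "S \<in> nsets Y \<tau>" for S
  proof -
    from that have "S \<subseteq> f ` X" "card S = \<tau>" by (auto simp: nsets_def Y)
    then obtain S' where S': "S' \<subseteq> X" "S = f ` S'" by (auto simp: subset_image_iff)
    then have "S' \<in> nsets X \<tau>"
      using \<open>card S = \<tau>\<close> inj X(1)
      by (auto simp: nsets_def card_image inj_on_subset intro: finite_subset)
    then have "card {B \<in> \<A>. S' \<subseteq> B} = \<mu>" by (rule S)
    moreover have "{B \<in> (`) f ` \<A>. S \<subseteq> B} = (`) f ` {B \<in> \<A>. S' \<subseteq> B}"
    proof -
      \<comment> \<open>Injectivity on \<open>X\<close> lets images reflect inclusion as well as
        preserve it, so the blocks above \<open>S\<close> are exactly the images of those above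
        \<open>S'\<close>.\<close>
      have "f ` S' \<subseteq> f ` B \<longleftrightarrow> S' \<subseteq> B" if "B \<in> \<A>" for B
        proof -
        have "B \<subseteq> X" using that X(2) by blast
        then have "f x \<in> f ` B \<longleftrightarrow> x \<in> B" if "x \<in> X" for x
          using inj_on_image_mem_iff[OF inj that] by blast
        then show ?thesis using S'(1) unfolding image_subset_iff by blast
      qed
      then show ?thesis unfolding S'(2) by blast
    qed
    moreover have "inj_on ((`) f) {B \<in> \<A>. S' \<subseteq> B}"
      by (rule inj_on_subset[OF inj_on_image_Pow[OF inj]]) (use X(2) in auto)
    ultimately show ?thesis by (simp add: card_image)
  qed
  moreover have "(`) f ` \<A> \<subseteq> Pow Y"
    using X(2) unfolding Y by blast
  ultimately show ?thesis
    using X(1,3) inj unfolding is_design_def set_system_def by (simp add: Y card_image)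
qed

text \<open>Double counting of the pairs of a \<open>\<tau>\<close>-subset and a block containing
  it: by blocks on the left, by subsets on the right.\<close>

lemma design_card_blocks:
  assumes "is_design \<tau> v w \<mu> X \<A>"
  shows "card \<A> * (w choose \<tau>) = \<mu> * (v choose \<tau>)"
proof -
  have X: "finite X" "\<A> \<subseteq> Pow X" "card X = v" "\<A> \<subseteq> nsets X w"
    and S: "\<forall>S \<in> nsets X \<tau>. card {B \<in> \<A>. S \<subseteq> B} = \<mu>"
    using assms by (auto simp: is_design_def set_system_def)
  have fin: "finite \<A>" using X by (meson finite_Pow_iff finite_subset)
  have sub: "card {S \<in> nsets X \<tau>. S \<subseteq> B} = w choose \<tau>" if "B \<in> \<A>" for B
  proof -
    have "B \<subseteq> X" "finite B" "card B = w" using that X by (auto simp: nsets_def)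
    then have "{S \<in> nsets X \<tau>. S \<subseteq> B} = nsets B \<tau>" by (auto simp: nsets_def)
    then show ?thesis using \<open>finite B\<close> \<open>card B = w\<close> by (simp add: card_nsets)
  qed
  have "(\<Sum>B\<in>\<A>. card {S \<in> nsets X \<tau>. S \<subseteq> B}) = \<mu> * card (nsets X \<tau>)"
    using sum_multicount[OF fin finite_imp_finite_nsets[OF X(1)] S] by simp
  then show ?thesis
    using sub X by (simp add: card_nsets)
qed

text \<open>Otherwise a \<open>\<tau>\<close>-subset of the intersection would lie in two different
  blocks, against index 1.\<close>

lemma design_card_Int_less:
  assumes "is_design \<tau> v w 1 X \<A>" and "A \<in> \<A>" "B \<in> \<A>" "A \<noteq> B"
  shows "card (A \<inter> B) < \<tau>"
proof (rule ccontr)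
  assume "\<not> card (A \<inter> B) < \<tau>"
  then obtain S where S: "S \<subseteq> A \<inter> B" "card S = \<tau>" "finite S"
    by (meson not_less obtain_subset_with_card_n)
  have "A \<subseteq> X" using assms by (auto simp: is_design_def set_system_def)
  then have "S \<in> nsets X \<tau>" using S by (auto simp: nsets_def)
  then have "card {B \<in> \<A>. S \<subseteq> B} = 1" using assms(1) unfolding is_design_def by blast
  then obtain C where "{B \<in> \<A>. S \<subseteq> B} = {C}" by (rule card_1_singletonE)
  moreover have "A \<in> {B \<in> \<A>. S \<subseteq> B}" "B \<in> {B \<in> \<A>. S \<subseteq> B}" using S(1) assms(2,3) by auto
  ultimately show False using \<open>A \<noteq> B\<close> by simp
qed

text \<open>Here \<open>m\<close> stands for \<open>\<tau> - 1\<close>, which keeps ceilings,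
  congruences and truncated subtraction out of the counting.\<close>

lemma design_extension_is_traceability_scheme:
  assumes des: "is_design (Suc m) v (m * t\<^sup>2 + 1) 1 X \<A>"
    and D: "finite D" "card D = d" "X \<inter> D = {}"
  shows "is_traceability_scheme t (m * t\<^sup>2 + 1 + d) (v + d) (X \<union> D) ((\<lambda>B. B \<union> D) ` \<A>)"
    (is "is_traceability_scheme t ?w _ _ ?\<B>")
proof -
  have X: "finite X" "card X = v" and blk: "\<And>B. B \<in> \<A> \<Longrightarrow> B \<subseteq> X \<and> finite B \<and> card B = m * t\<^sup>2 + 1"
    using des by (auto simp: is_design_def set_system_def nsets_def)
  have nsets: "?\<B> \<subseteq> nsets (X \<union> D) ?w"
  proof
    fix E assume "E \<in> ?\<B>"
    then obtain B where B: "B \<in> \<A>" "E = B \<union> D" by blast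
    then have "B \<inter> D = {}" using blk D by blast
    then show "E \<in> nsets (X \<union> D) ?w"
      using B blk[OF B(1)] D by (auto simp: nsets_def card_Un_disjoint)
  qed
  have traceable: False
    if s: "s \<le> t" and C: "\<forall>j\<in>{1..s}. C j \<in> ?\<B>" and T: "T \<in> nsets (\<Union>j\<in>{1..s}. C j) ?w"
      and B: "B \<in> ?\<B> - C ` {1..s}" and le: "\<forall>j\<in>{1..s}. card (T \<inter> B) \<ge> card (T \<inter> C j)"
    for s :: nat and C T B
  proof -
    have finT: "finite T" "card T = ?w" "T \<subseteq> (\<Union>j\<in>{1..s}. C j)" using T by (auto simp: nsets_def)
    define U where "U = T - D"
    \<comment> \<open>Every enlarged block contains \<open>D\<close>, so
      \<open>card (T \<inter> D)\<close> cancels in each comparison and only the old points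
      \<open>U\<close> matter.\<close>
    have split: "card (T \<inter> (E \<union> D)) = card (U \<inter> E) + card (T \<inter> D)" if "E \<in> \<A>" for E
    proof -
      have "T \<inter> (E \<union> D) = (U \<inter> E) \<union> (T \<inter> D)" "(U \<inter> E) \<inter> (T \<inter> D) = {}"
        by (auto simp: U_def)
      then show ?thesis using finT by (simp add: U_def card_Un_disjoint)
    qed
    obtain c where c: "\<And>j. j \<in> {1..s} \<Longrightarrow> c j \<in> \<A> \<and> C j = c j \<union> D"
      using C unfolding image_iff Bex_def by metis
    obtain b where b: "b \<in> \<A>" "B = b \<union> D" using B by blast
    have U: "U \<subseteq> (\<Union>j\<in>{1..s}. c j)"
    proof
      fix x assume "x \<in> U"
      then obtain j where "j \<in> {1..s}" "x \<in> C j" "x \<notin> D" using finT(3) unfolding U_def by blast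
      then show "x \<in> (\<Union>j\<in>{1..s}. c j)" using c[of j] by blast
    qed
    have finU: "finite U" using finT by (simp add: U_def)
    \<comment> \<open>Needed for two choices of \<open>V\<close>: \<open>U \<inter> b\<close> to
      bound the share of \<open>b\<close>, and \<open>U\<close> itself for the final
      contradiction.\<close>
    have cover: "card V \<le> (\<Sum>j\<in>{1..s}. card (V \<inter> c j))" if "V \<subseteq> U" for V
    proof -
      have "card V \<le> card (\<Union>j\<in>{1..s}. V \<inter> c j)"
        by (rule card_mono) (use that U finU in \<open>auto intro: finite_subset\<close>)
      also have "\<dots> \<le> (\<Sum>j\<in>{1..s}. card (V \<inter> c j))" by (rule card_UN_le) simp
      finally show ?thesis .
    qed
    have "card (U \<inter> b) \<le> (\<Sum>j\<in>{1..s}. card (U \<inter> b \<inter> c j))" by (rule cover) blast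
    also have "\<dots> \<le> (\<Sum>j\<in>{1..s}. m)"
    proof (rule sum_mono)
      fix j assume j: "j \<in> {1..s}"
      \<comment> \<open>Equality would give \<open>B = C j\<close>, but \<open>B\<close> is not
        among the chosen blocks.\<close>
      have "c j \<noteq> b" using j b c B by blast
      then have "card (b \<inter> c j) < Suc m"
        using design_card_Int_less[OF des b(1)] c[OF j] by metis
      moreover have "card (U \<inter> b \<inter> c j) \<le> card (b \<inter> c j)"
        by (rule card_mono) (use blk b in auto)
      ultimately show "card (U \<inter> b \<inter> c j) \<le> m" by simp
    qed
    also have "\<dots> \<le> m * t" using s by simp
    finally have "card (U \<inter> b) \<le> m * t" .
    moreover have "card (U \<inter> c j) \<le> card (U \<inter> b)" if "j \<in> {1..s}" for j
    proof -
      have "card (T \<inter> (c j \<union> D)) \<le> card (T \<inter> (b \<union> D))" using le that c[OF that] b(2) by metis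
      then show ?thesis using split[OF b(1)] split[of "c j"] c[OF that] by simp
    qed
    \<comment> \<open>The pigeonhole argument in contrapositive form: no \<open>c j\<close> beats
      \<open>b\<close>, so each holds at most \<open>m * t\<close> points of \<open>U\<close>, too
      few in total to cover it.\<close>
    ultimately have "(\<Sum>j\<in>{1..s}. card (U \<inter> c j)) \<le> (\<Sum>j\<in>{1..s}. m * t)"
      by (intro sum_mono) (meson order_trans)
    also have "\<dots> \<le> t * (m * t)" using s by simp
    finally have "card U \<le> m * t\<^sup>2" using cover[of U] by (simp add: power2_eq_square mult.left_commute)
    \<comment> \<open>Removing \<open>D\<close> costs at most \<open>d\<close> points, so
      \<open>U\<close> keeps at least \<open>m * t\<^sup>2 + 1\<close>.\<close>
    moreover have "card T - card D \<le> card U" unfolding U_def using D(1) by (rule diff_card_le_card_Diff)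
    ultimately show False using finT D by simp
  qed
  have "?\<B> \<subseteq> Pow (X \<union> D)" using blk by blast
  moreover have "finite (X \<union> D)" "card (X \<union> D) = v + d" using X D by (simp_all add: card_Un_disjoint)
  ultimately show ?thesis
    unfolding is_traceability_scheme_def set_system_def
    by - (intro conjI allI impI notI nsets; (assumption | (elim conjE bexE, rule traceable; assumption)))
qed

theorem theoremV3:
  fixes t w v d \<tau> :: nat
  assumes "t \<ge> 1" and "w \<ge> 1" and "v \<ge> 1" and "v \<ge> w"
    and "[w = d + 1] (mod t\<^sup>2)" and "d \<le> t\<^sup>2 - 1"
    and "\<tau> = nat \<lceil>real w / real (t\<^sup>2)\<rceil>"
    and "\<exists>(X :: 'a set) \<A>. is_design \<tau> (v - d) (w - d) 1 X \<A>"
  shows "\<exists>(Y :: nat set) \<B>. is_traceability_scheme t w v Y \<B> \<and>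
           real (card \<B>) = real ((v - d) choose \<tau>) / real ((w - d) choose \<tau>)"
proof -
  have t2: "t\<^sup>2 \<ge> 1" using assms(1) by simp
  \<comment> \<open>If \<open>w\<close> were smaller, \<open>d + 1 - w\<close> would be a multiple
    of \<open>t\<^sup>2\<close> strictly between 0 and \<open>t\<^sup>2\<close>.\<close>
  have "w \<ge> d + 1"
  proof (rule ccontr)
    assume "\<not> w \<ge> d + 1"
    then have "w < t\<^sup>2" "d + 1 - w < t\<^sup>2" "d + 1 - w > 0" "w \<le> d + 1" using assms(2,6) t2 by linarith+
    then show False
      using assms(5) by (metis cong_altdef_nat cong_sym nat_dvd_not_less)
  qed
  then have "t\<^sup>2 dvd w - (d + 1)" using assms(5) by (simp add: cong_altdef_nat)
  then obtain m where "w - (d + 1) = m * t\<^sup>2" by (metis dvdE mult.commute)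
  then have w: "w = m * t\<^sup>2 + 1 + d" using \<open>w \<ge> d + 1\<close> by linarith
  \<comment> \<open>The quotient is \<open>m\<close> plus a fraction in the half-open interval from
    0 (excluded) to 1 (included).\<close>
  have "\<lceil>real w / real (t\<^sup>2)\<rceil> = int m + 1"
  proof (rule ceiling_unique)
    have rt: "real (t\<^sup>2) > 0" using t2 by linarith
    have "real w = real m * real (t\<^sup>2) + real (d + 1)" unfolding w by simp
    then have eq: "real w / real (t\<^sup>2) = real m + real (d + 1) / real (t\<^sup>2)"
      using rt by (simp add: add_divide_distrib)
    have "d + 1 \<le> t\<^sup>2" using assms(6) t2 by linarith
    then have "real (d + 1) \<le> real (t\<^sup>2)" by (rule of_nat_mono)
    then have "real (d + 1) / real (t\<^sup>2) \<le> 1" using rt by simp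
    then show "real w / real (t\<^sup>2) \<le> of_int (int m + 1)" unfolding eq by simp
    have "real (d + 1) / real (t\<^sup>2) > 0" using rt by (intro divide_pos_pos) auto
    then show "of_int (int m + 1) - 1 < real w / real (t\<^sup>2)" unfolding eq by simp
  qed
  then have \<tau>: "\<tau> = Suc m" using assms(7) by simp
  obtain X :: "'a set" and \<A> where des: "is_design \<tau> (v - d) (w - d) 1 X \<A>" using assms(8) by blast
  then have "finite X" "card X = v - d" by (auto simp: is_design_def set_system_def)
  then obtain f where "bij_betw f X {0..<v - d}" using ex_bij_betw_finite_nat by metis
  then have des': "is_design \<tau> (v - d) (w - d) 1 {0..<v - d} ((`) f ` \<A>)" (is "is_design _ _ _ _ ?X ?A")
    using is_design_image[OF des] by blast
  \<comment> \<open>The next \<open>d\<close> naturals serve as new points, disjoint from the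
    transported design.\<close>
  let ?D = "{v - d..<v}"
  have dv: "d \<le> v" using w assms(4) by linarith
  have "is_traceability_scheme t (m * t\<^sup>2 + 1 + d) (v - d + d) (?X \<union> ?D) ((\<lambda>B. B \<union> ?D) ` ?A)"
    by (rule design_extension_is_traceability_scheme) (use des' dv in \<open>auto simp: \<tau> w\<close>)
  then have ts: "is_traceability_scheme t w v (?X \<union> ?D) ((\<lambda>B. B \<union> ?D) ` ?A)"
    using dv by (simp add: w)
  \<comment> \<open>Blocks avoid \<open>?D\<close>, so enlarging them merges none and the block
    count survives.\<close>
  have "inj_on (\<lambda>B. B \<union> ?D) ?A"
  proof (rule inj_onI)
    fix A B assume "A \<in> ?A" "B \<in> ?A" and eq: "A \<union> ?D = B \<union> ?D"
    then have "A \<subseteq> ?X" "B \<subseteq> ?X" using des' by (auto simp: is_design_def set_system_def)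
    then have "A \<inter> ?D = {}" "B \<inter> ?D = {}" by fastforce+
    then show "A = B" using eq by blast
  qed
  then have 1: "card ((\<lambda>B. B \<union> ?D) ` ?A) = card ?A" by (rule card_image)
  have 2: "real (card ?A) * real ((w - d) choose \<tau>) = real ((v - d) choose \<tau>)"
    using design_card_blocks[OF des'] by (simp flip: of_nat_mult)
  \<comment> \<open>This gives \<open>\<tau> \<le> w - d\<close>, so the denominator is nonzero and
    the quotient is not the default value of division by 0.\<close>
  have "m * 1 \<le> m * t\<^sup>2" using t2 by (intro mult_le_mono) auto
  then have "\<tau> \<le> w - d" by (simp add: w \<tau>)
  then have "real ((w - d) choose \<tau>) \<noteq> 0" by (simp add: binomial_eq_0_iff)
  then have "real (card ((\<lambda>B. B \<union> ?D) ` ?A)) = real ((v - d) choose \<tau>) / real ((w - d) choose \<tau>)"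
    unfolding 1 by (rule nonzero_eq_divide_eq[THEN iffD2, OF _ 2])
  then show ?thesis using ts by blast
qed

end
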